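(* Let $f=xz-y^{2}\in\mathbb{C}[x,y,z]$, let $S\subset\mathbb{C}^{3}$ be the surface defined by $P=xy-(f+1)(f+4)=0$, and let $$\partial=x\left(2f+5\right)\frac{\partial}{\partial y}+\left(x+2y\left(2f+5\right)\right)\frac{\partial}{\partial z}$$ which is a locally nilpotent derivation of $\mathbb{C}[x,y,z]$ annihilating $P$. Then the action of the additive group $\mathbb{C}_{+}$ on $S$ induced by $\partial$ is free. Its algebraic quotient $\pi:S\rightarrow S/\!/\mathbb{C}_{+}$ is identified with the projection $\mathrm{pr}_{x}|_{S}:S\rightarrow\mathbb{C}$, $(x,y,z)\mapsto x$.
   Context: A $\mathbb{C}$-derivation of a $\mathbb{C}$-algebra is locally nilpotent if every element is annihilated by some power of it. A locally nilpotent derivation $\partial$ of $\mathcal{O}(V)$, $V$ affine, defines an algebraic $\mathbb{C}_{+}$-action on $V$ by $f\mapsto\exp(t\partial)(f)$, $t\in\mathbb{C}$. Since $\partial P=0$, the derivation $\partial$ induces a locally nilpotent derivation of $\mathcal{O}(S)=\mathbb{C}[x,y,z]/(P)$, hence a $\mathbb{C}_{+}$-action on $S$. The algebraic quotient is $S/\!/\mathbb{C}_{+}=\operatorname{Spec}(\mathcal{O}(S)^{\mathbb{C}_{+}})$, and the quotient morphism is induced by the inclusion $\mathcal{O}(S)^{\mathbb{C}_{+}}\subset\mathcal{O}(S)$. *)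

theory Defs
  imports
    "HOL-Algebra.QuotRing"
    "HOL-Algebra.Group_Action"
    "HOL-Algebra.Algebraic_Closure_Type"
begin

text \<open>
  A commutative \<open>\<complex>\<close>-algebra is given by a ring \<open>R\<close> together with its structure map
  \<open>\<iota> : \<complex> \<rightarrow> R\<close>; scalar multiplication by \<open>c\<close> is multiplication by \<open>\<iota> c\<close>.
\<close>

definition C_alg_hom ::
  "(complex \<Rightarrow> 'a) \<Rightarrow> ('a, 'm) ring_scheme \<Rightarrow> (complex \<Rightarrow> 'b) \<Rightarrow> ('b, 'n) ring_scheme \<Rightarrow> ('a \<Rightarrow> 'b) set"
  where "C_alg_hom \<iota> R \<kappa> R' = {h \<in> ring_hom R R'. \<forall>c. h (\<iota> c) = \<kappa> c}"

definition C_alg_iso ::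
  "(complex \<Rightarrow> 'a) \<Rightarrow> ('a, 'm) ring_scheme \<Rightarrow> (complex \<Rightarrow> 'b) \<Rightarrow> ('b, 'n) ring_scheme \<Rightarrow> ('a \<Rightarrow> 'b) set"
  where "C_alg_iso \<iota> R \<kappa> R' = C_alg_hom \<iota> R \<kappa> R' \<inter> ring_iso R R'"

definition C_derivation :: "(complex \<Rightarrow> 'a) \<Rightarrow> ('a, 'm) ring_scheme \<Rightarrow> ('a \<Rightarrow> 'a) \<Rightarrow> bool"
  where "C_derivation \<iota> R D \<longleftrightarrow>
    D \<in> carrier R \<rightarrow> carrier R \<and>
    (\<forall>a\<in>carrier R. \<forall>b\<in>carrier R. D (a \<oplus>\<^bsub>R\<^esub> b) = D a \<oplus>\<^bsub>R\<^esub> D b) \<and>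
    (\<forall>c. \<forall>a\<in>carrier R. D (\<iota> c \<otimes>\<^bsub>R\<^esub> a) = \<iota> c \<otimes>\<^bsub>R\<^esub> D a) \<and>
    (\<forall>a\<in>carrier R. \<forall>b\<in>carrier R. D (a \<otimes>\<^bsub>R\<^esub> b) = (D a \<otimes>\<^bsub>R\<^esub> b) \<oplus>\<^bsub>R\<^esub> (a \<otimes>\<^bsub>R\<^esub> D b))"

definition locally_nilpotent_derivation ::
  "(complex \<Rightarrow> 'a) \<Rightarrow> ('a, 'm) ring_scheme \<Rightarrow> ('a \<Rightarrow> 'a) \<Rightarrow> bool"
  where "locally_nilpotent_derivation \<iota> R D \<longleftrightarrow>
    C_derivation \<iota> R D \<and> (\<forall>a\<in>carrier R. \<exists>n. (D ^^ n) a = \<zero>\<^bsub>R\<^esub>)"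

text \<open>
  The exponential series \<open>\<Sum>n. (t\<^sup>n / n!) D\<^sup>n a\<close>, taken over its nonzero terms; their number is
  finite when \<open>D\<close> is locally nilpotent.
\<close>

definition exp_derivation ::
  "(complex \<Rightarrow> 'a) \<Rightarrow> ('a, 'm) ring_scheme \<Rightarrow> ('a \<Rightarrow> 'a) \<Rightarrow> complex \<Rightarrow> 'a \<Rightarrow> 'a"
  where "exp_derivation \<iota> R D t a =
    (\<Oplus>\<^bsub>R\<^esub>n\<in>{n. (D ^^ n) a \<noteq> \<zero>\<^bsub>R\<^esub>}. \<iota> (t ^ n / fact n) \<otimes>\<^bsub>R\<^esub> (D ^^ n) a)"

definition invariant_ring ::
  "(complex \<Rightarrow> 'a) \<Rightarrow> 'a ring \<Rightarrow> ('a \<Rightarrow> 'a) \<Rightarrow> 'a ring"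
  where "invariant_ring \<iota> R D =
    R\<lparr>carrier := {a \<in> carrier R. \<forall>t. exp_derivation \<iota> R D t a = a}\<rparr>"

text \<open>
  The spectrum of an affine \<open>\<complex>\<close>-algebra, as an affine variety: its points are the \<open>\<complex>\<close>-algebra
  homomorphisms to \<open>\<complex>\<close> (by the Nullstellensatz, the maximal ideals), made extensional outside
  the carrier so that equality of points is equality of functions on the carrier.
\<close>

definition Spec :: "(complex \<Rightarrow> 'a) \<Rightarrow> ('a, 'm) ring_scheme \<Rightarrow> ('a \<Rightarrow> complex) set"
  where "Spec \<iota> R = C_alg_hom \<iota> R (\<lambda>c. c) ring_of_type_algebra \<inter> extensional (carrier R)"

text \<open>
  \<open>\<theta>\<close> is an isomorphism of the variety \<open>Spec R\<close> onto the affine line \<open>\<complex>\<close>, whose coordinate ring is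
  \<open>\<complex>[u]\<close>, and \<open>\<Theta> : \<complex>[u] \<rightarrow> R\<close> is its comorphism: the value of \<open>\<Theta> g\<close> at a point \<open>q\<close> is the value
  of \<open>g\<close> at \<open>\<theta> q\<close>.
\<close>

definition iso_onto_affine_line ::
  "(complex \<Rightarrow> 'a) \<Rightarrow> ('a, 'm) ring_scheme \<Rightarrow> (('a \<Rightarrow> complex) \<Rightarrow> complex) \<Rightarrow> (complex poly \<Rightarrow> 'a) \<Rightarrow> bool"
  where "iso_onto_affine_line \<iota> R \<theta> \<Theta> \<longleftrightarrow>
    bij_betw \<theta> (Spec \<iota> R) UNIV \<and>
    \<Theta> \<in> C_alg_iso (\<lambda>c. [:c:]) ring_of_type_algebra \<iota> R \<and>
    (\<forall>q\<in>Spec \<iota> R. \<forall>g. q (\<Theta> g) = poly g (\<theta> q))"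

text \<open>
  \<open>\<complex>[x,y,z]\<close> is represented as the iterated polynomial ring \<open>\<complex>[x][y][z]\<close>; the innermost variable
  is \<open>x\<close> and the outermost one is \<open>z\<close>.
\<close>

type_synonym poly3 = "complex poly poly poly"

definition const3 :: "complex \<Rightarrow> poly3" where "const3 c = [:[:[:c:]:]:]"

definition var_x :: poly3 where "var_x = [:[:[:0, 1:]:]:]"
definition var_y :: poly3 where "var_y = [:[:0, 1:]:]"
definition var_z :: poly3 where "var_z = [:0, 1:]"

definition diff_y :: "poly3 \<Rightarrow> poly3" where "diff_y = map_poly pderiv"
definition diff_z :: "poly3 \<Rightarrow> poly3" where "diff_z = pderiv"

definition eval3 :: "poly3 \<Rightarrow> complex \<times> complex \<times> complex \<Rightarrow> complex"
  where "eval3 a = (\<lambda>(x, y, z). poly (poly (poly a [:[:z:]:]) [:y:]) x)"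

definition f_poly :: poly3 where "f_poly = var_x * var_z - var_y ^ 2"

definition P_poly :: poly3 where "P_poly = var_x * var_y - (f_poly + 1) * (f_poly + 4)"

definition partial :: "poly3 \<Rightarrow> poly3"
  where "partial a =
    var_x * (2 * f_poly + 5) * diff_y a + (var_x + 2 * var_y * (2 * f_poly + 5)) * diff_z a"

definition S :: "(complex \<times> complex \<times> complex) set"
  where "S = {p. eval3 P_poly p = 0}"

definition poly3_ring :: "poly3 ring" where "poly3_ring = ring_of_type_algebra"

definition ideal_S :: "poly3 set" where "ideal_S = PIdl\<^bsub>poly3_ring\<^esub> P_poly"

definition O_S :: "poly3 set ring" where "O_S = poly3_ring Quot ideal_S"

definition residue :: "poly3 \<Rightarrow> poly3 set" where "residue a = ideal_S +>\<^bsub>poly3_ring\<^esub> a"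

definition const_S :: "complex \<Rightarrow> poly3 set" where "const_S c = residue (const3 c)"

text \<open>
  The value of a class at a point of \<open>S\<close> and the derivation of \<open>\<O>(S)\<close> induced by \<open>partial\<close> are
  computed on representatives; they are well defined by \<open>eval_S_residue\<close> and \<open>partial_S_residue\<close>
  below.
\<close>

definition eval_S :: "poly3 set \<Rightarrow> complex \<times> complex \<times> complex \<Rightarrow> complex"
  where "eval_S h p = the_elem ((\<lambda>a. eval3 a p) ` h)"

definition partial_S :: "poly3 set \<Rightarrow> poly3 set"
  where "partial_S h = the_elem ((\<lambda>a. residue (partial a)) ` h)"

definition additive_group :: "complex monoid"
  where "additive_group = \<lparr>carrier = UNIV, monoid.mult = (+), one = 0\<rparr>"

text \<open>
  The \<open>i\<close>-th coordinate of \<open>t \<cdot> p\<close> is the value at \<open>p\<close> of \<open>exp (t \<partial>)\<close> applied to the \<open>i\<close>-th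
  coordinate function of \<open>S\<close>.
\<close>

definition action_S :: "complex \<Rightarrow> complex \<times> complex \<times> complex \<Rightarrow> complex \<times> complex \<times> complex"
  where "action_S t = (\<lambda>p\<in>S.
    (eval_S (exp_derivation const_S O_S partial_S t (residue var_x)) p,
     eval_S (exp_derivation const_S O_S partial_S t (residue var_y)) p,
     eval_S (exp_derivation const_S O_S partial_S t (residue var_z)) p))"

definition O_S_invariants :: "poly3 set ring"
  where "O_S_invariants = invariant_ring const_S O_S partial_S"

text \<open>
  The morphism \<open>S \<rightarrow> Spec (\<O>(S)\<^sup>\<complex>\<^sup>+)\<close> induced by the inclusion: a point \<open>p\<close>, viewed as evaluation at
  \<open>p\<close> on \<open>\<O>(S)\<close>, is restricted to the invariants.
\<close>

definition quotient_morphism :: "complex \<times> complex \<times> complex \<Rightarrow> poly3 set \<Rightarrow> complex"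
  where "quotient_morphism p = (\<lambda>h\<in>carrier O_S_invariants. eval_S h p)"

definition pr_x :: "complex \<times> complex \<times> complex \<Rightarrow> complex"
  where "pr_x = (\<lambda>(x, y, z). x)"

text \<open>The comorphism \<open>\<complex>[u] \<rightarrow> \<O>(S)\<close>, \<open>g \<mapsto> g(x)\<close>, of \<open>pr_x\<close> restricted to \<open>S\<close>.\<close>

definition pr_x_comorphism :: "complex poly \<Rightarrow> poly3 set"
  where "pr_x_comorphism g = residue [:[:g:]:]"


lemma poly3_ring_cring: "cring poly3_ring"
  unfolding poly3_ring_def by (rule cring_from_type_algebra)

lemma residue_eq: "residue a = {b * P_poly + a | b. True}"
  by (auto simp: residue_def ideal_S_def cgenideal_def a_r_coset_def r_coset_def poly3_ring_def
      ring_of_type_algebra_def)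

lemma eval3_add: "eval3 (a + b) p = eval3 a p + eval3 b p"
  by (cases p) (simp add: eval3_def)

lemma eval3_mult: "eval3 (a * b) p = eval3 a p * eval3 b p"
  by (cases p) (simp add: eval3_def)

lemma eval_S_residue:
  assumes "p \<in> S"
  shows "eval_S (residue a) p = eval3 a p"
proof -
  have "(\<lambda>a. eval3 a p) ` residue a = {eval3 a p}"
    using assms by (auto simp: residue_eq S_def eval3_add eval3_mult image_iff)
  then show ?thesis by (simp add: eval_S_def)
qed

lemma diff_y_add: "diff_y (a + b) = diff_y a + diff_y b"
  by (intro poly_eqI) (simp add: diff_y_def coeff_map_poly pderiv_add)

lemma diff_y_mult: "diff_y (a * b) = diff_y a * b + a * diff_y b"
proof (rule poly_eqI)
  fix n
  have pderiv_sum: "pderiv (\<Sum>i\<in>A. g i) = (\<Sum>i\<in>A. pderiv (g i))"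
    for A :: "nat set" and g :: "nat \<Rightarrow> complex poly poly"
    by (induction A rule: infinite_finite_induct) (simp_all add: pderiv_add)
  have "coeff (diff_y (a * b)) n =
      (\<Sum>i\<le>n. pderiv (coeff a i) * coeff b (n - i) + coeff a i * pderiv (coeff b (n - i)))"
    by (simp add: diff_y_def coeff_map_poly coeff_mult pderiv_sum pderiv_mult ac_simps)
  also have "\<dots> = coeff (diff_y a * b + a * diff_y b) n"
    by (simp add: diff_y_def coeff_map_poly coeff_mult sum.distrib)
  finally show "coeff (diff_y (a * b)) n = coeff (diff_y a * b + a * diff_y b) n" .
qed

lemma partial_add: "partial (a + b) = partial a + partial b"
  by (simp add: partial_def diff_y_add diff_z_def pderiv_add algebra_simps)

lemma partial_mult: "partial (a * b) = partial a * b + a * partial b"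
  by (simp add: partial_def diff_y_mult diff_z_def pderiv_mult algebra_simps)

lemma partial_var:
  "partial var_x = 0"
  "partial var_y = var_x * (2 * f_poly + 5)"
  "partial var_z = var_x + 2 * var_y * (2 * f_poly + 5)"
proof -
  have "diff_y var_x = 0" "diff_y var_y = 1" "diff_y var_z = 0"
    by (simp_all add: diff_y_def var_x_def var_y_def var_z_def map_poly_pCons pderiv_pCons one_pCons)
  moreover have "diff_z var_x = 0" "diff_z var_y = 0" "diff_z var_z = 1"
    by (simp_all add: diff_z_def var_x_def var_y_def var_z_def pderiv_pCons)
  ultimately show "partial var_x = 0" "partial var_y = var_x * (2 * f_poly + 5)"
    "partial var_z = var_x + 2 * var_y * (2 * f_poly + 5)"
    by (simp_all only: partial_def mult_zero_right mult_1_right add_0_left add_0_right)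
qed

lemma partial_P: "partial P_poly = 0"
proof -
  have one: "partial 1 = 0"
    using partial_mult[of 1 1] by simp
  have minus: "partial (a - b) = partial a - partial b" for a b
    using partial_add[of "a - b" b] by simp
  have four: "partial 4 = 0"
  proof -
    have "partial (1 + 1 + 1 + 1) = 0"
      by (simp only: partial_add one add_0_left)
    then show ?thesis by simp
  qed
  have f: "partial f_poly = var_x ^ 2"
    unfolding f_poly_def power2_eq_square minus partial_mult partial_var
    by (simp add: algebra_simps)
  show ?thesis
    unfolding P_poly_def minus partial_mult partial_add partial_var one four f
    by (simp add: algebra_simps power2_eq_square)
qed

lemma residue_add_multiple: "residue (b * P_poly + a) = residue a"
proof -
  have "residue (b * P_poly + a) \<subseteq> residue a" for a b
    unfolding residue_eq by (auto simp: add.assoc[symmetric] distrib_right[symmetric])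
  from this[of b a] this[of "- b" "b * P_poly + a"] show ?thesis by simp
qed

lemma partial_S_residue: "partial_S (residue a) = residue (partial a)"
proof -
  have "residue (partial b) = residue (partial a)" if "b \<in> residue a" for b
  proof -
    from that obtain c where "b = c * P_poly + a"
      unfolding residue_eq by blast
    then have "partial b = partial c * P_poly + partial a"
      by (simp only: partial_add partial_mult partial_P mult_zero_right add_0_right)
    then show ?thesis
      by (simp only: residue_add_multiple)
  qed
  moreover have "a \<in> residue a"
  proof -
    have "a = 0 * P_poly + a" by (simp only: mult_zero_left add_0_left)
    then show ?thesis unfolding residue_eq by blast
  qed
  ultimately have "(\<lambda>a. residue (partial a)) ` residue a = {residue (partial a)}"
    by blast
  then show ?thesis by (simp only: partial_S_def the_elem_eq)
qed

end

theory Submission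
  imports Defs "HOL-Analysis.Complex_Analysis_Basics"
begin

text \<open>
  Since \<open>\<partial>x = 0\<close> and \<open>\<partial>f = x\<^sup>2\<close>, the derivation integrates to an explicit polynomial flow
  which preserves \<open>S\<close> and moves \<open>f\<close> to \<open>f + t x\<^sup>2\<close>. The derivative of a polynomial \<open>a\<close> along the
  flow is \<open>\<partial>a\<close>, so its Taylor expansion in \<open>t\<close> is \<open>exp (t\<partial>) a\<close>. A fixed point has \<open>x = 0\<close>; there
  the flow is the translation of \<open>z\<close> by \<open>2 t y (2 f + 5)\<close>, and \<open>y \<noteq> 0\<close>, \<open>f \<in> {-1, -4}\<close> because \<open>P = 0\<close>.

  Modulo \<open>P\<close>, some \<open>x\<^sup>n a\<close> is a polynomial \<open>G(x, f)\<close>. The points of \<open>S\<close> with \<open>x \<noteq> 0\<close> are parametrised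
  by \<open>(x, f)\<close> and the orbits there are the fibres of \<open>x\<close>, so an invariant \<open>a\<close> has \<open>G\<close> independent
  of \<open>f\<close>. Finally \<open>x\<close> is a prime not dividing \<open>P\<close> and vanishes somewhere on \<open>S\<close>, hence \<open>x\<^sup>n\<close> cancels
  and \<open>a\<close> lies in \<open>\<complex>[x]\<close> modulo \<open>P\<close>.
\<close>

section \<open>Induction over polynomials in three variables, and evaluation at points\<close>

lemma poly3_induct [case_names const var_x var_y var_z add mult]:
  assumes const: "\<And>c. Q (const3 c)"
    and "Q var_x" "Q var_y" "Q var_z"
    and add: "\<And>a b. Q a \<Longrightarrow> Q b \<Longrightarrow> Q (a + b)"
    and mult: "\<And>a b. Q a \<Longrightarrow> Q b \<Longrightarrow> Q (a * b)"
  shows "Q a"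
proof -
  have zero: "Q 0"
    using const[of 0] by (simp add: const3_def)
  \<comment> \<open>Three nested inductions, one per variable from the innermost outwards, each
    peeling off one coefficient in Horner form.\<close>
  have x: "Q [:[:g:]:]" for g
  proof (induction g)
    case (pCons c g)
    have "[:[:pCons c g:]:] = const3 c + var_x * [:[:g:]:]"
      by (simp add: const3_def var_x_def)
    then show ?case
      by (simp only:) (intro add mult const \<open>Q var_x\<close> pCons.IH)
  qed (simp add: zero)
  have xy: "Q [:h:]" for h
  proof (induction h)
    case (pCons g h)
    have "[:pCons g h:] = [:[:g:]:] + var_y * [:h:]"
      by (simp add: var_y_def)
    then show ?case
      by (simp only:) (intro add mult x \<open>Q var_y\<close> pCons.IH)
  qed (simp add: zero)
  show ?thesis
  proof (induction a)
    case (pCons h a)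
    have "pCons h a = [:h:] + var_z * a"
      by (simp add: var_z_def)
    then show ?case
      by (simp only:) (intro add mult xy \<open>Q var_z\<close> pCons.IH)
  qed (simp add: zero)
qed

lemma eval3_const3 [simp]: "eval3 (const3 c) p = c"
  by (cases p) (simp add: eval3_def const3_def)

lemma eval3_embed_x: "eval3 [:[:g:]:] (x, y, z) = poly g x"
  by (simp add: eval3_def)

lemma eval3_var [simp]:
  "eval3 var_x (x, y, z) = x" "eval3 var_y (x, y, z) = y" "eval3 var_z (x, y, z) = z"
  by (simp_all add: eval3_def var_x_def var_y_def var_z_def)

lemma eval3_simps [simp]:
  "eval3 (a + b) p = eval3 a p + eval3 b p"
  "eval3 (a - b) p = eval3 a p - eval3 b p"
  "eval3 (a * b) p = eval3 a p * eval3 b p"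
  "eval3 (a ^ n) p = eval3 a p ^ n"
  "eval3 0 p = 0" "eval3 1 p = 1" "eval3 (numeral k) p = numeral k"
  by (cases p; simp add: eval3_def)+

lemma eval3_sum [simp]: "eval3 (\<Sum>i\<in>I. g i) p = (\<Sum>i\<in>I. eval3 (g i) p)"
  by (induction I rule: infinite_finite_induct) simp_all

lemma eval3_f_poly [simp]: "eval3 f_poly (x, y, z) = x * z - y\<^sup>2"
  by (simp add: f_poly_def)

lemma eval3_P_poly: "eval3 P_poly (x, y, z) = x * y - (x * z - y\<^sup>2 + 1) * (x * z - y\<^sup>2 + 4)"
  by (simp add: P_poly_def)

lemma mem_S_iff: "(x, y, z) \<in> S \<longleftrightarrow> x * y = (x * z - y\<^sup>2 + 1) * (x * z - y\<^sup>2 + 4)"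
  by (simp add: S_def eval3_P_poly)

lemma eval3_eq_on_S: "P_poly dvd a - b \<Longrightarrow> p \<in> S \<Longrightarrow> eval3 a p = eval3 b p"
  by (auto simp: S_def dvd_def dest!: arg_cong[where f = "\<lambda>c. eval3 c p"])


section \<open>The derivation on polynomials\<close>

lemma partial_const3 [simp]: "partial (const3 c) = 0"
  by (simp add: partial_def diff_y_def diff_z_def const3_def map_poly_pCons pderiv_pCons)

lemma partial_0 [simp]: "partial 0 = 0"
  using partial_add[of 0 0] by simp

lemma partial_embed_x [simp]: "partial [:[:g:]:] = 0"
  by (simp add: partial_def diff_y_def diff_z_def map_poly_pCons pderiv_pCons)

lemma partial_funpow_0 [simp]: "(partial ^^ n) 0 = 0"
  by (induction n) simp_all

lemma partial_funpow_add: "(partial ^^ n) (a + b) = (partial ^^ n) a + (partial ^^ n) b"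
  by (induction n) (simp_all add: partial_add)

lemma partial_funpow_eq_0_mono: "(partial ^^ n) a = 0 \<Longrightarrow> n \<le> m \<Longrightarrow> (partial ^^ m) a = 0"
  by (metis funpow_add le_add_diff_inverse2 o_apply partial_funpow_0)

text \<open>By the Leibniz rule each summand of \<open>partial (a * b)\<close> lowers one of the two
  exponents, so induction on \<open>m + n\<close> applies; if \<open>m\<close> or \<open>n\<close>
  is 0, a factor itself is zero.\<close>

lemma partial_funpow_mult_eq_0:
  "(partial ^^ m) a = 0 \<Longrightarrow> (partial ^^ n) b = 0 \<Longrightarrow> (partial ^^ (m + n)) (a * b) = 0"
proof (induction "m + n" arbitrary: m n a b)
  case (Suc k)
  show ?case
  proof (cases "m = 0 \<or> n = 0")
    case False
    then obtain m' n' where mn: "m = Suc m'" "n = Suc n'"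
      by (metis not0_implies_Suc)
    have "(partial ^^ (m' + n)) (partial a * b) = 0" "(partial ^^ (m + n')) (a * partial b) = 0"
      by (rule Suc.hyps(1); use Suc mn in \<open>simp add: funpow_Suc_right del: funpow.simps\<close>)+
    moreover have "m + n' = m' + n"
      by (simp add: mn)
    ultimately have "(partial ^^ Suc (m' + n)) (a * b) = 0"
      by (simp only: funpow_Suc_right o_apply partial_mult partial_funpow_add add_0)
    with mn show ?thesis by simp
  qed (use Suc.prems in auto)
qed simp

lemma partial_f_poly: "partial f_poly = var_x\<^sup>2"
proof -
  have "partial (var_x * var_z - var_y\<^sup>2) + partial (var_y * var_y) = partial (var_x * var_z)"
    by (simp add: partial_add[symmetric] power2_eq_square)
  then show ?thesis
    unfolding f_poly_def partial_mult partial_var by (simp add: algebra_simps power2_eq_square)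
qed

text \<open>Elements killed by some power form a subalgebra, and \<open>a\<close> lies in it as soon
  as \<open>partial a\<close> does. This admits x, then f (its image is x^2), then y (image in
  C[x,f]) and z (image in C[x,y,f]).\<close>

lemma partial_nilpotent: "\<exists>n. (partial ^^ n) a = 0"
proof -
  define nilp where "nilp a \<longleftrightarrow> (\<exists>n. (partial ^^ n) a = 0)" for a
  have add: "nilp (a + b)" if ab: "nilp a" "nilp b" for a b
  proof -
    obtain m n where "(partial ^^ m) a = 0" "(partial ^^ n) b = 0"
      using ab nilp_def by auto
    then have "(partial ^^ max m n) a = 0" "(partial ^^ max m n) b = 0"
      by (auto intro: partial_funpow_eq_0_mono)
    then show ?thesis
      unfolding nilp_def by (metis partial_funpow_add add_0)
  qed
  have mult: "nilp (a * b)" if "nilp a" "nilp b" for a b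
    using that partial_funpow_mult_eq_0 unfolding nilp_def by blast
  have step: "nilp a" if "nilp (partial a)" for a
    using that unfolding nilp_def by (metis funpow_Suc_right o_apply)
  have const: "nilp (const3 c)" for c
    by (rule step) (auto simp: nilp_def intro: exI[of _ 0])
  have numerals: "nilp 2" "nilp 5"
    using const[of 2] const[of 5] by (simp_all add: const3_def numeral_poly)
  have x: "nilp var_x"
    by (rule step) (auto simp: nilp_def partial_var intro: exI[of _ 0])
  have "nilp f_poly"
    by (rule step) (simp add: partial_f_poly power2_eq_square mult x)
  then have w: "nilp (2 * f_poly + 5)"
    by (intro add mult numerals)
  have y: "nilp var_y"
    by (rule step) (simp only: partial_var mult x w)
  have z: "nilp var_z"
    by (rule step) (simp only: partial_var mult add x y w numerals)
  have "nilp a"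
    by (induction a rule: poly3_induct) (use const x y z add mult in auto)
  then show ?thesis by (simp add: nilp_def)
qed


section \<open>The flow of the derivation\<close>

text \<open>The solution of the differential equation given by \<open>partial\<close>: x is constant
  and 2 f + 5 equals w + 2 t x^2 at time t. Integrating x (2 f + 5) gives the second coordinate, and
  integrating x + 2 y (2 f + 5) along it gives the third.\<close>

fun flow :: "complex \<Rightarrow> complex \<times> complex \<times> complex \<Rightarrow> complex \<times> complex \<times> complex"
  where "flow t (x, y, z) = (let w = 2 * (x * z - y\<^sup>2) + 5 in
    (x, y + t * x * w + t\<^sup>2 * x ^ 3,
     z + t * (x + 2 * y * w) + t\<^sup>2 * (x * w\<^sup>2 + 2 * x\<^sup>2 * y) + 2 * t ^ 3 * x ^ 3 * w + t ^ 4 * x ^ 5))"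

lemma flow_0 [simp]: "flow 0 p = p"
  by (cases p) (simp add: Let_def)

lemma eval3_f_poly_flow: "eval3 f_poly (flow t p) = eval3 f_poly p + t * (pr_x p)\<^sup>2"
  by (cases p) (simp add: Let_def pr_x_def eval_nat_numeral algebra_simps)

lemma pr_x_flow [simp]: "pr_x (flow t p) = pr_x p"
  by (cases p) (simp add: Let_def pr_x_def)

lemma flow_flow: "flow s (flow t p) = flow (s + t) p"
proof (cases p)
  case (fields x y z)
  define w where "w = 2 * (x * z - y\<^sup>2) + 5"
  obtain x' y' z' where p': "flow t p = (x', y', z')"
    by (cases "flow t p")
  then have eqs: "x' = x" "y' = y + t * x * w + t\<^sup>2 * x ^ 3"
     "z' = z + t * (x + 2 * y * w) + t\<^sup>2 * (x * w\<^sup>2 + 2 * x\<^sup>2 * y) + 2 * t ^ 3 * x ^ 3 * w + t ^ 4 * x ^ 5"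
    by (auto simp: fields Let_def w_def)
  have f: "x' * z' - y'\<^sup>2 = x * z - y\<^sup>2 + t * x\<^sup>2"
    using eval3_f_poly_flow[of t p] unfolding p' by (simp add: fields pr_x_def)
  \<comment> \<open>The second flow starts with w + 2 t x^2 in place of w; with w kept opaque, the
    rest is a polynomial identity.\<close>
  have w': "2 * (x' * z' - y'\<^sup>2) + 5 = w + 2 * t * x\<^sup>2"
    unfolding w_def f by (simp add: algebra_simps)
  show ?thesis
    unfolding p' flow.simps Let_def w' unfolding fields flow.simps Let_def w_def[symmetric] eqs
    by (simp add: algebra_simps power2_eq_square power3_eq_cube power4_eq_xxxx eval_nat_numeral)
qed

lemma flow_in_S: "flow t p \<in> S" if "p \<in> S"
proof (cases p)
  case (fields x y z)
  obtain x' y' z' where p': "flow t p = (x', y', z')"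
    by (cases "flow t p")
  define v where "v = x * z - y\<^sup>2"
  have f: "x' * z' - y'\<^sup>2 = v + t * x\<^sup>2"
    using eval3_f_poly_flow[of t p] unfolding p' by (simp add: fields pr_x_def v_def)
  have "x' = x" "y' = y + t * x * (2 * v + 5) + t\<^sup>2 * x ^ 3"
    using p' by (auto simp: fields Let_def v_def)
  \<comment> \<open>Both x y and (f + 1)(f + 4) grow by t x^2 (2 v + 5) + t^2 x^4.\<close>
  with that[unfolded fields mem_S_iff, folded v_def] show ?thesis
    unfolding p' mem_S_iff f by (simp add: algebra_simps eval_nat_numeral)
qed

lemma flow_free:
  assumes "p \<in> S" "flow t p = p"
  shows "t = 0"
proof (rule ccontr)
  assume t: "t \<noteq> 0"
  obtain x y z where p: "p = (x, y, z)"
    by (cases p)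
  from eval3_f_poly_flow[of t p] assms t have x: "x = 0"
    by (simp add: p pr_x_def)
  with assms have "(1 - y\<^sup>2) * (4 - y\<^sup>2) = 0"
    by (simp add: p mem_S_iff)
  then have "y\<^sup>2 = 1 \<or> y\<^sup>2 = 4"
    by auto
  \<comment> \<open>At x = 0 the flow adds 2 t y (5 - 2 y^2) to z, so this factor must vanish; that
    is incompatible with y^2 being 1 or 4.\<close>
  moreover have "y = 0 \<or> 2 * y\<^sup>2 = 5"
    using assms t x by (auto simp: p Let_def)
  ultimately show False
    by auto
qed

text \<open>Differentiation in t and \<open>partial\<close> obey the same sum and product rules, so
  constants and coordinates suffice; for the coordinates this says that \<open>flow\<close> solves
  the differential equation.\<close>

lemma flow_has_field_derivative:
  "((\<lambda>t. eval3 a (flow t p)) has_field_derivative eval3 (partial a) (flow t p)) (at t)"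
proof (induction a rule: poly3_induct)
  case (add a b)
  then show ?case by (auto simp: partial_add intro!: derivative_eq_intros)
next
  case (mult a b)
  then show ?case by (auto simp: partial_mult intro!: derivative_eq_intros)
next
  case (const c)
  then show ?case by simp
next
  case var_x
  then show ?case by (cases p) (simp add: partial_var Let_def)
next
  case var_y
  show ?case
  proof (cases p)
    case (fields x y z)
    have "eval3 (partial var_y) (flow t p) = pr_x (flow t p) * (2 * eval3 f_poly (flow t p) + 5)"
      by (cases "flow t p") (simp add: partial_var pr_x_def)
    also have "\<dots> = x * (2 * (x * z - y\<^sup>2 + t * x\<^sup>2) + 5)"
      by (simp add: eval3_f_poly_flow, simp add: fields pr_x_def)
    finally show ?thesis
      by (auto simp: fields Let_def power2_eq_square power3_eq_cube algebra_simps
        intro!: derivative_eq_intros)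
  qed
next
  case var_z
  show ?case
  proof (cases p)
    case (fields x y z)
    define w where "w = 2 * (x * z - y\<^sup>2) + 5"
    have "eval3 (partial var_z) (flow t p) =
        pr_x (flow t p) + 2 * eval3 var_y (flow t p) * (2 * eval3 f_poly (flow t p) + 5)"
      by (cases "flow t p") (simp add: partial_var pr_x_def)
    also have "\<dots> = x + 2 * (y + t * x * w + t\<^sup>2 * x ^ 3) * (w + 2 * t * x\<^sup>2)"
      by (simp add: eval3_f_poly_flow, simp add: fields pr_x_def Let_def w_def algebra_simps)
    finally have *: "eval3 (partial var_z) (flow t p) = \<dots>" .
    have **: "(\<lambda>t. eval3 var_z (flow t p)) = (\<lambda>t. z + t * (x + 2 * y * w)
        + t\<^sup>2 * (x * w\<^sup>2 + 2 * x\<^sup>2 * y) + 2 * t ^ 3 * x ^ 3 * w + t ^ 4 * x ^ 5)"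
      by (simp add: fields Let_def w_def)
    show ?thesis
      unfolding * ** by (rule derivative_eq_intros refl | simp)+ (simp add: eval_nat_numeral algebra_simps)
  qed
qed

text \<open>Induction on \<open>N\<close>: the expansion is known for \<open>partial a\<close>,
  which is killed one step earlier, and is integrated in t.\<close>

lemma eval3_flow:
  assumes "(partial ^^ N) a = 0"
  shows "eval3 a (flow t p) = (\<Sum>n<N. t ^ n / fact n * eval3 ((partial ^^ n) a) p)"
  using assms
proof (induction N arbitrary: a t)
  case (Suc N)
  \<comment> \<open>\<open>h\<close> is the antiderivative, vanishing at 0, of the expansion of
    \<open>partial a\<close>; hence \<open>a\<close> along the flow differs from \<open>h\<close> by
    its value at t = 0.\<close>
  define h where "h t = (\<Sum>n<N. t ^ Suc n / fact (Suc n) * eval3 ((partial ^^ Suc n) a) p)" for t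
  have "(partial ^^ N) (partial a) = 0"
    using Suc.prems by (simp add: funpow_swap1)
  note IH = Suc.IH[OF this]
  have "(h has_field_derivative eval3 (partial a) (flow t p)) (at t)" for t
  proof -
    have "((\<lambda>t. t ^ Suc n / fact (Suc n) * c) has_field_derivative t ^ n / fact n * c) (at t)"
      for n and c :: complex
    proof -
      have "((\<lambda>t. t ^ Suc n) has_field_derivative of_nat (Suc n) * t ^ n) (at t)"
        by (auto intro!: derivative_eq_intros simp del: of_nat_Suc power_Suc)
      from DERIV_cmult_right[OF this, of "c / fact (Suc n)"] show ?thesis
        by (simp del: of_nat_Suc power_Suc)
    qed
    then show ?thesis
      unfolding h_def IH funpow_Suc_right o_apply by (intro DERIV_sum)
  qed
  then have "((\<lambda>t. eval3 a (flow t p) - h t) has_field_derivative 0) (at t within UNIV)" for t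
    using DERIV_diff[OF flow_has_field_derivative[of a p t], of h] by fastforce
  then obtain c where c: "\<And>t. eval3 a (flow t p) - h t = c"
    using has_field_derivative_zero_constant[of UNIV "\<lambda>t. eval3 a (flow t p) - h t"] by auto
  have "c = eval3 a p"
    using c[of 0] by (simp add: h_def)
  then have "eval3 a (flow t p) = eval3 a p + h t"
    using c[of t] by (simp add: algebra_simps)
  then show ?case
    unfolding sum.lessThan_Suc_shift h_def by simp
qed simp


section \<open>Polynomials modulo the equation of the surface\<close>

lemma prime_elem_var_x: "prime_elem var_x"
proof -
  have "prime_elem [:0, 1::complex:]"
    by (rule prime_elem_linear_field_poly) simp
  then show ?thesis
    unfolding var_x_def by (intro lift_prime_elem_poly)
qed

lemma var_x_not_dvd_P_poly: "\<not> var_x dvd P_poly"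
proof
  assume "var_x dvd P_poly"
  then obtain c where "P_poly = var_x * c" ..
  \<comment> \<open>At the origin x vanishes, whereas P takes the value -4.\<close>
  then have "eval3 P_poly (0, 0, 0) = eval3 (var_x * c) (0, 0, 0)"
    by simp
  then show False
    by (simp add: eval3_P_poly)
qed

lemma P_poly_dvd_cancel_var_x:
  assumes "P_poly dvd var_x ^ n * a"
  shows "P_poly dvd a"
  using assms
proof (induction n)
  case (Suc n)
  then obtain c where c: "var_x * (var_x ^ n * a) = P_poly * c"
    by (auto simp: dvd_def mult.assoc)
  then have "var_x dvd P_poly * c"
    by (intro dvdI[of _ _ "var_x ^ n * a"]) (rule sym)
  then have "var_x dvd c"
    using prime_elem_dvd_multD[OF prime_elem_var_x] var_x_not_dvd_P_poly by blast
  then obtain d where "c = var_x * d" ..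
  with c have "var_x * (var_x ^ n * a) = var_x * (P_poly * d)"
    by (simp only: mult.left_commute)
  moreover have "var_x \<noteq> 0"
    using prime_elem_var_x by (rule prime_elem_not_zeroI)
  ultimately have "var_x ^ n * a = P_poly * d"
    using mult_left_cancel by blast
  with Suc.IH show ?case by simp
qed simp

text \<open>The polynomial \<open>G(x, f)\<close>, for \<open>G \<in> \<complex>[x][u]\<close>.\<close>

definition poly_xf :: "complex poly poly \<Rightarrow> poly3"
  where "poly_xf G = poly (map_poly (\<lambda>g. [:[:g:]:]) G) f_poly"

lemma poly_xf_0 [simp]: "poly_xf 0 = 0"
  by (simp add: poly_xf_def)

lemma poly_xf_pCons [simp]: "poly_xf (pCons g G) = [:[:g:]:] + f_poly * poly_xf G"
  by (simp add: poly_xf_def map_poly_pCons)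

lemma poly_xf_add [simp]: "poly_xf (G + H) = poly_xf G + poly_xf H"
proof (induction G H rule: poly_induct2)
  case (pCons g G h H)
  then show ?case by (simp only: add_pCons poly_xf_pCons) (simp add: algebra_simps)
qed simp

lemma poly_xf_smult [simp]: "poly_xf (smult g G) = [:[:g:]:] * poly_xf G"
  by (induction G) (simp_all add: algebra_simps)

lemma poly_xf_mult [simp]: "poly_xf (G * H) = poly_xf G * poly_xf H"
  by (induction G) (simp_all add: algebra_simps)

lemma eval3_poly_xf: "eval3 (poly_xf G) (x, y, z) = poly (poly G [:x * z - y\<^sup>2:]) x"
  by (induction G) (simp_all add: eval3_embed_x)

text \<open>On \<open>x \<noteq> 0\<close> the surface is the graph over \<open>(x, f)\<close> of \<open>y = (f + 1)(f + 4) / x\<close> and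
  \<open>z = (f + y\<^sup>2) / x\<close>, so that \<open>x y\<close> and \<open>x\<^sup>3 z\<close> are polynomials in \<open>x, f\<close> modulo \<open>P\<close>.\<close>

lemma ex_poly_xf_mod_P: "\<exists>n G. P_poly dvd var_x ^ n * a - poly_xf G"
proof -
  \<comment> \<open>\<open>u\<close> and \<open>v\<close> are preimages of f and x under the ring
    homomorphism \<open>poly_xf\<close>.\<close>
  define u :: "complex poly poly" where "u = [:0, 1:]"
  define v :: "complex poly poly" where "v = [:[:0, 1:]:]"
  have one: "poly_xf 1 = 1"
    by (simp add: poly_xf_def map_poly_1 flip: one_pCons)
  have u: "poly_xf u = f_poly" and v: "poly_xf v = var_x"
    by (simp_all add: u_def v_def var_x_def one flip: one_pCons)
  have vn: "poly_xf (v ^ n) = var_x ^ n" for n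
    by (induction n) (simp_all add: v one)
  have numerals: "poly_xf (numeral k) = numeral k" for k
    by (simp add: numeral_poly)
  show ?thesis
  proof (induction a rule: poly3_induct)
    case (const c)
    have "P_poly dvd var_x ^ 0 * const3 c - poly_xf [:[:c:]:]"
      by (simp add: const3_def)
    then show ?case by blast
  next
    case var_x
    have "P_poly dvd var_x ^ 0 * var_x - poly_xf v"
      by (simp add: v)
    then show ?case by blast
  next
    case var_y
    have "var_x ^ 1 * var_y - poly_xf ((u + 1) * (u + 4)) = P_poly"
      by (simp add: u one numerals P_poly_def)
    then show ?case by (metis dvd_refl)
  next
    case var_z
    let ?w = "(f_poly + 1) * (f_poly + 4)"
    \<comment> \<open>Since x z = f + y^2, x^3 z equals x^2 f + (x y)^2. Replacing x y by
      \<open>?w\<close> leaves a difference of squares, one of whose factors is P.\<close>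
    have "var_x ^ 3 * var_z - poly_xf (v\<^sup>2 * u + ((u + 1) * (u + 4))\<^sup>2)
      = var_x\<^sup>2 * (var_x * var_z) - var_x\<^sup>2 * f_poly - ?w\<^sup>2"
      by (simp add: u one numerals power2_eq_square v power3_eq_cube algebra_simps)
    also have "var_x * var_z = f_poly + var_y\<^sup>2"
      by (simp add: f_poly_def)
    also have "var_x\<^sup>2 * (f_poly + var_y\<^sup>2) - var_x\<^sup>2 * f_poly - ?w\<^sup>2 = (var_x * var_y - ?w) * (var_x * var_y + ?w)"
      by (simp add: square_diff_square_factored power2_eq_square algebra_simps)
    finally show ?case
      unfolding P_poly_def by (metis dvd_triv_left)
  next
    case (add a b)
    then obtain m n G H where
      "P_poly dvd var_x ^ m * a - poly_xf G" "P_poly dvd var_x ^ n * b - poly_xf H"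
      by blast
    \<comment> \<open>Cross-multiplying brings both summands to the common power x^(m+n).\<close>
    then have "P_poly dvd var_x ^ n * (var_x ^ m * a - poly_xf G) + var_x ^ m * (var_x ^ n * b - poly_xf H)"
      by (intro dvd_add dvd_mult)
    also have "\<dots> = var_x ^ (m + n) * (a + b) - poly_xf (v ^ n * G + v ^ m * H)"
      by (simp add: vn power_add algebra_simps)
    finally show ?case by blast
  next
    case (mult a b)
    then obtain m n G H where
      "P_poly dvd var_x ^ m * a - poly_xf G" "P_poly dvd var_x ^ n * b - poly_xf H"
      by blast
    then have "P_poly dvd (var_x ^ m * a - poly_xf G) * (var_x ^ n * b) + poly_xf G * (var_x ^ n * b - poly_xf H)"
      by (intro dvd_add dvd_mult dvd_mult2)
    also have "\<dots> = var_x ^ (m + n) * (a * b) - poly_xf (G * H)"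
      by (simp add: power_add algebra_simps)
    finally show ?case by blast
  qed
qed

section \<open>Points of S with nonzero x, and polynomials invariant under the flow\<close>

lemma ex_point_of_S:
  assumes "x \<noteq> 0"
  shows "\<exists>y z. (x, y, z) \<in> S \<and> x * z - y\<^sup>2 = u"
proof -
  define y where "y = (u + 1) * (u + 4) / x"
  have "x * ((u + y\<^sup>2) / x) - y\<^sup>2 = u" "x * y = (u + 1) * (u + 4)"
    using assms by (simp_all add: y_def)
  then show ?thesis
    by (intro exI[of _ y] exI[of _ "(u + y\<^sup>2) / x"]) (simp only: mem_S_iff simp_thms)
qed

text \<open>For fixed u the difference is a polynomial in x with infinitely many roots, hence zero.
  So \<open>G - H\<close>, over the domain C[x], has every constant u as a root and vanishes
  too.\<close>

lemma bivariate_poly_eqI: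
  fixes G H :: "complex poly poly"
  assumes "\<And>x u. x \<noteq> 0 \<Longrightarrow> poly (poly G [:u:]) x = poly (poly H [:u:]) x"
  shows "G = H"
proof -
  have inf: "infinite (- {0 :: complex})"
    by (simp add: infinite_UNIV_char_0 Compl_eq_Diff_UNIV)
  have "poly G [:u:] - poly H [:u:] = 0" for u
  proof (rule ccontr)
    assume "poly G [:u:] - poly H [:u:] \<noteq> 0"
    from poly_roots_finite[OF this] have "finite (- {0 :: complex})"
      by (rule rev_finite_subset) (auto simp: assms)
    with inf show False by simp
  qed
  then have *: "range (\<lambda>u. [:u:]) \<subseteq> {q. poly (G - H) q = 0}"
    by auto
  have "inj (\<lambda>u. [:u :: complex:])"
    by (rule injI) simp
  then have "infinite (range (\<lambda>u. [:u :: complex:]))"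
    using finite_imageD infinite_UNIV_char_0 by blast
  with * have "infinite {q. poly (G - H) q = 0}"
    using finite_subset by blast
  then have "G - H = 0"
    using poly_roots_finite by blast
  then show ?thesis by simp
qed

lemma embed_x_mod_P_cancel:
  assumes "P_poly dvd var_x ^ n * a - [:[:g:]:]"
  shows "\<exists>h. P_poly dvd a - [:[:h:]:]"
  using assms
proof (induction n arbitrary: g)
  case (Suc n)
  \<comment> \<open>A point of S where x vanishes (there f = -1): evaluating the congruence at it
    yields g(0) = 0, so x splits off \<open>g\<close> and can be cancelled modulo P.\<close>
  have "(0, 1, 0) \<in> S"
    by (simp add: mem_S_iff)
  from eval3_eq_on_S[OF Suc.prems this] have "poly g 0 = 0"
    by (simp add: eval3_embed_x)
  then have "[:0, 1:] dvd g"
    by (simp add: poly_eq_0_iff_dvd)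
  then obtain h where "g = [:0, 1:] * h" ..
  then have "[:[:g:]:] = var_x * [:[:h:]:]"
    by (simp add: var_x_def)
  then have "var_x ^ Suc n * a - [:[:g:]:] = var_x ^ 1 * (var_x ^ n * a - [:[:h:]:])"
    by (simp only: power_Suc power_one_right mult.assoc right_diff_distrib)
  with Suc.prems have "P_poly dvd var_x ^ n * a - [:[:h:]:]"
    by (simp only:) (rule P_poly_dvd_cancel_var_x)
  then show ?case by (rule Suc.IH)
qed auto

lemma flow_invariant_mod_P:
  assumes inv: "\<And>t p. p \<in> S \<Longrightarrow> eval3 a (flow t p) = eval3 a p"
  shows "\<exists>g. P_poly dvd a - [:[:g:]:]"
proof -
  obtain n G where G: "P_poly dvd var_x ^ n * a - poly_xf G"
    using ex_poly_xf_mod_P by blast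
  \<comment> \<open>The right-hand side is the coefficient of u^0, so the claim is that
    \<open>G\<close> does not involve u.\<close>
  have "G = [:poly G 0:]"
  proof (rule bivariate_poly_eqI)
    fix x u :: complex
    assume x: "x \<noteq> 0"
    obtain y z where p: "(x, y, z) \<in> S" "x * z - y\<^sup>2 = 0"
      using ex_point_of_S[OF x] by blast
    \<comment> \<open>The time at which the flow carries f = 0 to f = u, since f moves by t x^2
      while x stays fixed.\<close>
    define t where "t = u / x\<^sup>2"
    obtain x' y' z' where q: "flow t (x, y, z) = (x', y', z')"
      by (cases "flow t (x, y, z)")
    have x': "x' = x"
      using pr_x_flow[of t "(x, y, z)"] unfolding q by (simp add: pr_x_def)
    have u: "x' * z' - y'\<^sup>2 = u"
      using eval3_f_poly_flow[of t "(x, y, z)"] x p(2) unfolding q by (simp add: pr_x_def t_def)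
    have "poly (poly G [:u:]) x = x ^ n * eval3 a (flow t (x, y, z))"
      using eval3_eq_on_S[OF G flow_in_S[OF p(1), of t]] unfolding q
      by (simp add: eval3_poly_xf u[unfolded x'] x')
    also have "\<dots> = poly (poly G [:0:]) x"
      using eval3_eq_on_S[OF G p(1)] by (simp add: inv[OF p(1)] eval3_poly_xf p(2) del: flow.simps)
    finally show "poly (poly G [:u:]) x = poly (poly [:poly G 0:] [:u:]) x"
      by simp
  qed
  then have "poly_xf G = poly_xf [:poly G 0:]"
    by (rule arg_cong)
  with G have "P_poly dvd var_x ^ n * a - [:[:poly G 0:]:]"
    by (simp only: poly_xf_pCons poly_xf_0 mult_zero_right add_0_right)
  then show ?thesis
    by (rule embed_x_mod_P_cancel)
qed

text \<open>The projection of S to the x-axis hits every nonzero x, so the two polynomials agree at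
  infinitely many points; they are viewed as constant in u.\<close>

lemma embed_x_mod_P_inject:
  assumes "P_poly dvd [:[:g:]:] - [:[:h:]:]"
  shows "g = h"
proof -
  have "[:g:] = [:h:]"
  proof (rule bivariate_poly_eqI)
    fix x u :: complex
    assume "x \<noteq> 0"
    then obtain y z where "(x, y, z) \<in> S"
      using ex_point_of_S by blast
    from eval3_eq_on_S[OF assms this] show "poly (poly [:g:] [:u:]) x = poly (poly [:h:] [:u:]) x"
      by (simp add: eval3_embed_x)
  qed
  then show ?thesis by simp
qed


section \<open>The coordinate ring of the surface\<close>

lemma poly3_ring_simps [simp]:
  "carrier poly3_ring = UNIV" "a \<oplus>\<^bsub>poly3_ring\<^esub> b = a + b" "a \<otimes>\<^bsub>poly3_ring\<^esub> b = a * b"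
  "\<zero>\<^bsub>poly3_ring\<^esub> = 0" "\<one>\<^bsub>poly3_ring\<^esub> = 1"
  by (simp_all add: poly3_ring_def ring_of_type_algebra_def)

lemma ideal_ideal_S: "ideal ideal_S poly3_ring"
  unfolding ideal_S_def by (rule cring.cgenideal_ideal[OF poly3_ring_cring]) simp

lemma O_S_cring: "cring O_S"
  unfolding O_S_def by (rule ideal.quotient_is_cring[OF ideal_ideal_S poly3_ring_cring])

lemma residue_hom: "residue \<in> ring_hom poly3_ring O_S"
  using ideal.rcos_ring_hom[OF ideal_ideal_S] unfolding O_S_def residue_def[abs_def] .

lemma O_S_simps [simp]:
  "residue a \<oplus>\<^bsub>O_S\<^esub> residue b = residue (a + b)" "residue a \<otimes>\<^bsub>O_S\<^esub> residue b = residue (a * b)"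
  using ring_hom_add[OF residue_hom] ring_hom_mult[OF residue_hom] by simp_all

lemma carrier_O_S: "carrier O_S = range residue"
  by (auto simp: O_S_def FactRing_def A_RCOSETS_def' residue_def)

lemma residue_in_carrier [simp]: "residue a \<in> carrier O_S"
  by (simp add: carrier_O_S)

lemma one_O_S: "\<one>\<^bsub>O_S\<^esub> = residue 1"
  using ring_hom_one[OF residue_hom] by simp

lemma zero_O_S: "\<zero>\<^bsub>O_S\<^esub> = residue 0"
proof -
  interpret O: cring O_S by (rule O_S_cring)
  have "residue 0 \<oplus>\<^bsub>O_S\<^esub> residue 0 = residue 0"
    by simp
  then show ?thesis
    by (metis O.add.r_cancel_one residue_in_carrier)
qed

lemma residue_eq_iff: "residue a = residue b \<longleftrightarrow> P_poly dvd a - b"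
proof
  assume "residue a = residue b"
  moreover have "a = 0 * P_poly + a"
    by (simp only: mult_zero_left add_0_left)
  then have "a \<in> residue a"
    unfolding residue_eq by blast
  ultimately obtain c where "a = c * P_poly + b"
    unfolding residue_eq by blast
  then show "P_poly dvd a - b"
    by simp
next
  assume "P_poly dvd a - b"
  then obtain c where "a - b = P_poly * c" ..
  then have "a = c * P_poly + b"
    by (simp add: algebra_simps)
  then show "residue a = residue b"
    by (simp only: residue_add_multiple)
qed

lemma residue_sum: "(\<Oplus>\<^bsub>O_S\<^esub>n\<in>I. residue (g n)) = residue (\<Sum>n\<in>I. g n)" if "finite I"
proof -
  interpret O: cring O_S by (rule O_S_cring)
  show ?thesis
    using that by (induction I) (simp_all add: zero_O_S)
qed

lemma partial_S_funpow_residue: "(partial_S ^^ n) (residue a) = residue ((partial ^^ n) a)"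
  by (induction n) (simp_all add: partial_S_residue)

lemma partial_derivation: "C_derivation const3 poly3_ring partial"
  by (simp add: C_derivation_def partial_add partial_mult)

lemma partial_S_derivation: "C_derivation const_S O_S partial_S"
  using partial_derivation
  by (auto simp: C_derivation_def carrier_O_S const_S_def partial_S_residue)

lemma partial_S_nilpotent: "h \<in> carrier O_S \<Longrightarrow> \<exists>n. (partial_S ^^ n) h = \<zero>\<^bsub>O_S\<^esub>"
  by (auto simp: carrier_O_S partial_S_funpow_residue zero_O_S)
    (metis partial_nilpotent)

lemma exp_derivation_residue:
  assumes "(partial ^^ N) a = 0"
  shows "exp_derivation const_S O_S partial_S t (residue a) =
    residue (\<Sum>n<N. const3 (t ^ n / fact n) * (partial ^^ n) a)"
proof -
  interpret O: cring O_S by (rule O_S_cring)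
  let ?I = "{n. (partial_S ^^ n) (residue a) \<noteq> \<zero>\<^bsub>O_S\<^esub>}"
  \<comment> \<open>The exponential runs over the nonzero terms only; extending it to all indices
    below \<open>N\<close> adds zeros.\<close>
  have "?I \<subseteq> {..<N}"
    using partial_funpow_eq_0_mono[OF assms]
    by (auto simp: partial_S_funpow_residue zero_O_S not_le[symmetric])
  then have "exp_derivation const_S O_S partial_S t (residue a) =
      (\<Oplus>\<^bsub>O_S\<^esub>n\<in>{..<N}. const_S (t ^ n / fact n) \<otimes>\<^bsub>O_S\<^esub> (partial_S ^^ n) (residue a))"
    unfolding exp_derivation_def
    by (intro O.add.finprod_mono_neutral_cong_left)
      (auto simp: const_S_def partial_S_funpow_residue)
  then show ?thesis
    by (simp add: const_S_def partial_S_funpow_residue residue_sum)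
qed

text \<open>The bridge from algebra to geometry: both sides are the same finite Taylor sum once some
  power of \<open>partial\<close> kills \<open>a\<close>.\<close>

lemma eval_S_exp_derivation:
  assumes "p \<in> S"
  shows "eval_S (exp_derivation const_S O_S partial_S t (residue a)) p = eval3 a (flow t p)"
proof -
  obtain N where N: "(partial ^^ N) a = 0"
    using partial_nilpotent by blast
  show ?thesis
    by (simp add: exp_derivation_residue[OF N] eval_S_residue[OF assms] eval3_flow[OF N])
qed

section \<open>The action of the additive group on S\<close>

lemma action_S_eq_flow: "action_S t = restrict (flow t) S"
proof -
  have "(eval3 var_x q, eval3 var_y q, eval3 var_z q) = q" for q
    by (cases q) simp
  then show ?thesis
    unfolding action_S_def by (intro restrict_ext) (simp add: eval_S_exp_derivation)
qed

lemma group_action_S: "group_action additive_group S action_S"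
proof -
  have group: "group additive_group"
    by (rule groupI) (auto simp: additive_group_def add.assoc intro: exI[of _ "- x" for x] add.left_inverse)
  have comp: "compose S (action_S s) (action_S t) = action_S (s + t)" for s t
    by (rule ext) (simp add: action_S_eq_flow compose_def restrict_def flow_in_S flow_flow)
  have in_S: "action_S t p \<in> S" if "p \<in> S" for t p
    using that by (simp add: action_S_eq_flow flow_in_S)
  have inv: "action_S (- t) (action_S t p) = p" if "p \<in> S" for t p
    using that by (simp add: action_S_eq_flow flow_in_S flow_flow)
  have Bij: "action_S t \<in> Bij S" for t
  proof -
    have "bij_betw (action_S t) S S"
      by (rule bij_betw_byWitness[where f' = "action_S (- t)"])
        (use in_S inv[of _ t] inv[of _ "- t"] in auto)
    moreover have "action_S t \<in> extensional S"
      by (simp add: action_S_eq_flow)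
    ultimately show ?thesis
      by (simp add: Bij_def)
  qed
  then have "action_S \<in> hom additive_group (BijGroup S)"
    by (auto simp: hom_def additive_group_def BijGroup_def comp)
  with group show ?thesis
    by (simp add: group_action_def group_hom_def group_hom_axioms_def group_BijGroup)
qed

lemma stabilizer_action_S:
  assumes "p \<in> S"
  shows "stabilizer additive_group action_S p = {\<one>\<^bsub>additive_group\<^esub>}"
  using assms flow_free[OF assms]
  by (auto simp: stabilizer_def additive_group_def action_S_eq_flow simp del: flow.simps)


section \<open>The invariants\<close>

lemma O_S_invariants_simps [simp]:
  "h \<oplus>\<^bsub>O_S_invariants\<^esub> k = h \<oplus>\<^bsub>O_S\<^esub> k" "h \<otimes>\<^bsub>O_S_invariants\<^esub> k = h \<otimes>\<^bsub>O_S\<^esub> k"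
  "\<one>\<^bsub>O_S_invariants\<^esub> = \<one>\<^bsub>O_S\<^esub>"
  by (simp_all add: O_S_invariants_def invariant_ring_def)

lemma carrier_invariants: "carrier O_S_invariants = range pr_x_comorphism"
proof (intro equalityI subsetI)
  fix h
  assume "h \<in> carrier O_S_invariants"
  then obtain a where h: "h = residue a"
    and inv: "\<And>t. exp_derivation const_S O_S partial_S t (residue a) = residue a"
    by (auto simp: O_S_invariants_def invariant_ring_def carrier_O_S)
  \<comment> \<open>Evaluating at points of S turns invariance in the coordinate ring into
    invariance under the flow.\<close>
  have "eval3 a (flow t p) = eval3 a p" if "p \<in> S" for t p
    using eval_S_exp_derivation[OF that, of t a] eval_S_residue[OF that, of a] inv by simp
  from flow_invariant_mod_P[OF this] show "h \<in> range pr_x_comorphism"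
    by (auto simp: h pr_x_comorphism_def residue_eq_iff)
next
  fix h
  assume "h \<in> range pr_x_comorphism"
  then obtain g where h: "h = residue [:[:g:]:]"
    by (auto simp: pr_x_comorphism_def)
  \<comment> \<open>A polynomial in x is killed by \<open>partial\<close>, so its exponential
    reduces to the term of index 0.\<close>
  have "(partial ^^ 1) [:[:g:]:] = 0"
    by simp
  from exp_derivation_residue[OF this] show "h \<in> carrier O_S_invariants"
    by (simp add: O_S_invariants_def invariant_ring_def h const3_def)
qed

section \<open>The spectrum of the invariants as the affine line\<close>

lemma inj_pr_x_comorphism: "inj pr_x_comorphism"
  by (auto intro!: injI embed_x_mod_P_inject simp: pr_x_comorphism_def residue_eq_iff)

lemma pr_x_comorphism_iso:
  "pr_x_comorphism \<in> C_alg_iso (\<lambda>c. [:c:]) ring_of_type_algebra const_S O_S_invariants"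
proof -
  have "pr_x_comorphism \<in> ring_hom ring_of_type_algebra O_S_invariants"
    by (rule ring_hom_memI)
      (simp_all add: carrier_invariants ring_of_type_algebra_def,
       simp_all add: pr_x_comorphism_def one_O_S flip: one_pCons)
  moreover have "bij_betw pr_x_comorphism UNIV (carrier O_S_invariants)"
    by (simp add: bij_betw_def inj_pr_x_comorphism carrier_invariants)
  ultimately show ?thesis
    by (simp add: C_alg_iso_def C_alg_hom_def ring_iso_def ring_of_type_algebra_def
        pr_x_comorphism_def const_S_def const3_def)
qed

text \<open>A C-algebra homomorphism out of a ring generated by the class of x is determined by its
  value there; the induction follows the Horner form of \<open>g\<close>.\<close>

lemma Spec_invariants_pr_x_comorphism:
  assumes "q \<in> Spec const_S O_S_invariants"
  shows "q (pr_x_comorphism g) = poly g (q (pr_x_comorphism [:0, 1:]))"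
proof -
  have hom: "q \<in> ring_hom O_S_invariants ring_of_type_algebra" and const: "q (const_S c) = c" for c
    using assms by (auto simp: Spec_def C_alg_hom_def)
  have in_carrier: "pr_x_comorphism g \<in> carrier O_S_invariants" for g
    by (simp add: carrier_invariants)
  show ?thesis
  proof (induction g)
    case 0
    have "pr_x_comorphism 0 = const_S 0"
      by (simp add: pr_x_comorphism_def const_S_def const3_def)
    then show ?case
      by (simp add: const)
  next
    case (pCons c g)
    have "pr_x_comorphism (pCons c g) =
        const_S c \<oplus>\<^bsub>O_S\<^esub> (pr_x_comorphism [:0, 1:] \<otimes>\<^bsub>O_S\<^esub> pr_x_comorphism g)"
      by (simp add: pr_x_comorphism_def const_S_def const3_def)
    moreover have "const_S c = pr_x_comorphism [:c:]"
      by (simp add: pr_x_comorphism_def const_S_def const3_def)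
    moreover have "pr_x_comorphism [:0, 1:] \<otimes>\<^bsub>O_S\<^esub> pr_x_comorphism g = pr_x_comorphism ([:0, 1:] * g)"
      by (simp add: pr_x_comorphism_def)
    ultimately show ?case
      using ring_hom_add[OF hom in_carrier in_carrier, of "[:c:]" "[:0, 1:] * g"]
        ring_hom_mult[OF hom in_carrier in_carrier, of "[:0, 1:]" g] const[of c]
      by (simp add: ring_of_type_algebra_def pCons.IH)
  qed
qed

lemma Spec_invariants_iso:
  "iso_onto_affine_line const_S O_S_invariants (\<lambda>q. q (pr_x_comorphism [:0, 1:])) pr_x_comorphism"
proof -
  let ?\<theta> = "\<lambda>q. q (pr_x_comorphism [:0, 1:])"
  let ?Spec = "Spec const_S O_S_invariants"
  have "inj_on ?\<theta> ?Spec"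
  proof (rule inj_onI)
    fix q r
    assume qr: "q \<in> ?Spec" "r \<in> ?Spec" "?\<theta> q = ?\<theta> r"
    show "q = r"
    proof (rule extensionalityI)
      show "q \<in> extensional (carrier O_S_invariants)" "r \<in> extensional (carrier O_S_invariants)"
        using qr by (auto simp: Spec_def)
    next
      fix h
      assume "h \<in> carrier O_S_invariants"
      then obtain g where h: "h = pr_x_comorphism g"
        by (auto simp: carrier_invariants)
      show "q h = r h"
        unfolding h Spec_invariants_pr_x_comorphism[OF qr(1), of g]
          Spec_invariants_pr_x_comorphism[OF qr(2), of g] qr(3) ..
    qed
  qed
  moreover have "u \<in> ?\<theta> ` ?Spec" for u
  proof -
    \<comment> \<open>The point over u: evaluation at u, transported through the inverse of the
      comorphism.\<close>
    define q where "q = (\<lambda>h\<in>carrier O_S_invariants. poly (inv_into UNIV pr_x_comorphism h) u)"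
    have q: "q (pr_x_comorphism g) = poly g u" for g
      by (simp add: q_def carrier_invariants inv_f_f[OF inj_pr_x_comorphism])
    have ops: "pr_x_comorphism g \<oplus>\<^bsub>O_S\<^esub> pr_x_comorphism h = pr_x_comorphism (g + h)"
      "pr_x_comorphism g \<otimes>\<^bsub>O_S\<^esub> pr_x_comorphism h = pr_x_comorphism (g * h)"
      "\<one>\<^bsub>O_S\<^esub> = pr_x_comorphism 1" "const_S c = pr_x_comorphism [:c:]" for g h c
      by (simp_all add: pr_x_comorphism_def one_O_S const_S_def const3_def flip: one_pCons)
    have "q \<in> ring_hom O_S_invariants ring_of_type_algebra"
      by (rule ring_hom_memI)
        (auto simp: carrier_invariants ops q ring_of_type_algebra_def)
    then have "q \<in> ?Spec"
      by (simp add: Spec_def C_alg_hom_def ops q) (simp add: q_def)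
    moreover have "?\<theta> q = u"
      by (simp add: q)
    ultimately show ?thesis
      by blast
  qed
  ultimately show ?thesis
    using pr_x_comorphism_iso Spec_invariants_pr_x_comorphism
    by (auto simp: iso_onto_affine_line_def bij_betw_def)
qed

lemma quotient_morphism_pr_x:
  assumes "p \<in> S"
  shows "quotient_morphism p (pr_x_comorphism [:0, 1:]) = pr_x p"
  using assms
  by (cases p)
    (simp add: quotient_morphism_def carrier_invariants, simp add: pr_x_comorphism_def eval_S_residue eval3_embed_x pr_x_def)

theorem proposition1p9:
  shows "locally_nilpotent_derivation const3 poly3_ring partial \<and>
    partial P_poly = 0 \<and>
    locally_nilpotent_derivation const_S O_S partial_S \<and>
    group_action additive_group S action_S \<and>
    (\<forall>t. \<forall>p\<in>S. \<forall>h\<in>carrier O_S.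
      eval_S h (action_S t p) = eval_S (exp_derivation const_S O_S partial_S t h) p) \<and>
    (\<forall>p\<in>S. stabilizer additive_group action_S p = {\<one>\<^bsub>additive_group\<^esub>}) \<and>
    (\<exists>\<theta>. iso_onto_affine_line const_S O_S_invariants \<theta> pr_x_comorphism \<and>
      (\<forall>p\<in>S. \<theta> (quotient_morphism p) = pr_x p))"
proof (intro conjI ballI allI)
  show "locally_nilpotent_derivation const3 poly3_ring partial"
    by (simp add: locally_nilpotent_derivation_def partial_derivation partial_nilpotent)
  show "partial P_poly = 0"
    by (rule partial_P)
  show "locally_nilpotent_derivation const_S O_S partial_S"
    by (simp add: locally_nilpotent_derivation_def partial_S_derivation partial_S_nilpotent)
  show "group_action additive_group S action_S"
    by (rule group_action_S)
  show "eval_S h (action_S t p) = eval_S (exp_derivation const_S O_S partial_S t h) p"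
    if "p \<in> S" "h \<in> carrier O_S" for t p h
    using that
    by (auto simp: carrier_O_S action_S_eq_flow eval_S_exp_derivation eval_S_residue flow_in_S
        simp del: flow.simps)
  show "stabilizer additive_group action_S p = {\<one>\<^bsub>additive_group\<^esub>}" if "p \<in> S" for p
    using that by (rule stabilizer_action_S)
  show "\<exists>\<theta>. iso_onto_affine_line const_S O_S_invariants \<theta> pr_x_comorphism \<and>
      (\<forall>p\<in>S. \<theta> (quotient_morphism p) = pr_x p)"
    \<comment> \<open>Here \<open>\<theta>\<close> takes the value of a point of the spectrum at the
      class of x.\<close>
    using Spec_invariants_iso quotient_morphism_pr_x by blast
qed

end
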